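(* Let $N\ge 1$, let $\mathbf{V}=(V_1,\dots,V_N)$ be an innately regular collection of closed linear subspaces of a real Hilbert space $H$, let $\eta\in(0,1]$, and let $\gamma>0$ be arbitrary. There exists a constant $C=C(\mathbf{V},\eta,\gamma)<\infty$ such that for all $x_0\in H$, all sequences $(i_n)_{n\ge 0}$ in $\{1,\dots,N\}$ and all sequences $(\lambda_n)_{n\ge 0}$ in $[\eta,2-\eta]$, the trajectory $(x_n)_{n\ge0}$ defined by $x_{n+1}:=P_{i_n,\lambda_n}(x_n)$, $n\ge 0$, satisfies $$\sum_{n=0}^\infty\|x_{n+1}-x_{n}\|^\gamma \leq C\,\|x_0\|^\gamma.$$
   Context: For $1\le i\le N$, $P_i$ denotes the orthogonal projection of $H$ onto $V_i$, and for $\lambda\in[0,2]$ its relaxation is $P_{i,\lambda}(x):=(1-\lambda)x+\lambda P_i(x)$, $x\in H$. For a closed subspace $V$, $d(x,V)$ denotes the distance from $x$ to $V$. A finite collection $(W_1,\dots,W_m)$ of closed linear subspaces of $H$ is called regular if there is a constant $\kappa<\infty$ such that $d(x,W_1\cap\dots\cap W_m)\le \kappa\max_i d(x,W_i)$ for all $x\in H$. The collection $\mathbf{V}=(V_1,\dots,V_N)$ is called innately regular if every nonempty subcollection $(V_i)_{i\in I}$, $\emptyset\ne I\subset\{1,\dots,N\}$, is regular. *)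

theory Defs
  imports "HOL-Analysis.Analysis"
begin

(* The library's closest_point requires Heine-Borel, i.e. finite dimension, hence this definition.
   The description is meaningful when V is a closed subspace of a Hilbert space: the projection
   theorem then gives exactly one such y. *)
definition orth_proj :: "'a::real_inner set \<Rightarrow> 'a \<Rightarrow> 'a" where
  "orth_proj V x = (THE y. y \<in> V \<and> (\<forall>v\<in>V. orthogonal (x - y) v))"

definition relaxed_proj :: "'a::real_inner set \<Rightarrow> real \<Rightarrow> 'a \<Rightarrow> 'a" where
  "relaxed_proj V l x = (1 - l) *\<^sub>R x + l *\<^sub>R orth_proj V x"

(* Intended for finite nonempty I; closedness and linearity of the members W i are separate
   hypotheses wherever these notions are used. *)
definition regular_family :: "'i set \<Rightarrow> ('i \<Rightarrow> 'a::real_inner set) \<Rightarrow> bool" where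
  "regular_family I W \<longleftrightarrow>
     (\<exists>\<kappa>::real. \<forall>x. infdist x (\<Inter>i\<in>I. W i) \<le> \<kappa> * Max ((\<lambda>i. infdist x (W i)) ` I))"

definition innately_regular :: "'i set \<Rightarrow> ('i \<Rightarrow> 'a::real_inner set) \<Rightarrow> bool" where
  "innately_regular J V \<longleftrightarrow> (\<forall>I. I \<noteq> {} \<and> I \<subseteq> J \<longrightarrow> regular_family I V)"

end

theory Submission
  imports Defs
begin

text \<open>
  A relaxed projection onto \<open>V i\<close> has two metric properties: it is strongly Fejer monotone (the
  squared distance to every point of \<open>V i\<close> drops by at least a fixed multiple of the squared step
  length), and its step length is at least \<open>\<eta>\<close> times the distance to \<open>V i\<close>
  (\<open>relaxed_proj_fejer\<close>, \<open>relaxed_proj_progress\<close>). Together with regularity of all subfamilies,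
  these properties imply the estimate for sets with a common point in any
  metric space.

  The argument is an induction on the finite set \<open>I\<close> of indices that may occur. Write
  \<open>gap I x\<close> for the distance from \<open>x\<close> to \<open>\<Inter>i\<in>I. V i\<close>. The inductive statement has two halves.

  \<^item> If every index of \<open>I\<close> occurs in a trajectory and all its steps have length at most \<open>\<delta>\<close>, then
    the initial gap is at most \<open>K * \<delta>\<close>, with \<open>K\<close> independent of the length of the trajectory
    (\<open>controls_gap_step\<close>). Cut the trajectory just before the first occurrence of the index
    that appears last. The part before it uses a smaller index set \<open>I'\<close>, so its initial
    \<open>I'\<close>-gap is \<open>O(\<delta>)\<close>; by the second half with exponent 1 for \<open>I'\<close>, the total length of that
    part is \<open>O(\<delta>)\<close> as well. The next step, of length at most \<open>\<delta>\<close>, shows that the point reached is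
    close to the one remaining set, and hence so is the initial point. Now the initial point is
    close to every \<open>V i\<close>, and regularity bounds its \<open>I\<close>-gap.

  \<^item> The \<open>\<gamma>\<close>-th powers of the step lengths sum to at most a constant times the \<open>\<gamma>\<close>-th power of
    the initial gap (\<open>summable_steps_step\<close>). By the first half and Fejer monotonicity, every
    trajectory that uses all of \<open>I\<close> shrinks the gap by a fixed factor \<open>q < 1\<close>
    (\<open>covering_contracts\<close>). Split a trajectory into minimal blocks that use all of \<open>I\<close>. All but the
    last step of a block use a smaller index set, so the induction hypothesis applies to them, and
    the last step is bounded by Fejer monotonicity. Each block thus contributes at most a constant
    times the \<open>\<gamma>\<close>-th power of its initial gap, and these powers are dominated by a geometric series.
\<close>

section \<open>Relaxed projections in a Hilbert space\<close>

text \<open>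
  The existence half of the projection theorem: by the parallelogram law a minimising sequence for
  the distance is Cauchy, so completeness replaces compactness.
\<close>

lemma exists_orthogonal_projection:
  fixes V :: "'a::{real_inner,complete_space} set"
  assumes V: "subspace V" and cl: "closed V"
  shows "\<exists>y\<in>V. \<forall>v\<in>V. orthogonal (x - y) v"
proof -
  define d where "d = infdist x V"
  have ne: "V \<noteq> {}" using V subspace_0 by blast
  have d0: "0 \<le> d" by (simp add: d_def infdist_nonneg)
  have d_le: "d \<le> dist x v" if "v \<in> V" for v using that by (simp add: d_def infdist_le)
  have "\<exists>v\<in>V. (dist x v)\<^sup>2 < d\<^sup>2 + inverse (real (Suc n))" for n
  proof (rule ccontr)
    assume "\<not> ?thesis"
    then have *: "d\<^sup>2 + inverse (real (Suc n)) \<le> (dist x v)\<^sup>2" if "v \<in> V" for v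
      using that by force
    have "sqrt (d\<^sup>2 + inverse (real (Suc n))) \<le> d"
      unfolding d_def infdist_notempty[OF ne]
      by (rule cINF_greatest[OF ne]) (use * in \<open>auto intro!: real_le_lsqrt simp: d_def infdist_notempty[OF ne]\<close>)
    then have "d\<^sup>2 + inverse (real (Suc n)) \<le> d\<^sup>2"
      by (rule sqrt_le_D)
    then show False by simp
  qed
  then obtain y where yV: "\<And>n. y n \<in> V"
    and y: "\<And>n. (dist x (y n))\<^sup>2 < d\<^sup>2 + inverse (real (Suc n))"
    by metis
  have near: "(dist (y m) (y n))\<^sup>2 \<le> 2 * inverse (real (Suc m)) + 2 * inverse (real (Suc n))" for m n
  proof -
    have "(1/2) *\<^sub>R (y m + y n) \<in> V" using V yV by (simp add: subspace_add subspace_scale)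
    from d_le[OF this] have "d\<^sup>2 \<le> (dist x ((1/2) *\<^sub>R (y m + y n)))\<^sup>2" using d0 by (simp add: power_mono)
    \<comment> \<open>the parallelogram law for the two vectors from \<open>x\<close> to \<open>y m\<close> and to \<open>y n\<close>\<close>
    moreover have "(dist (y m) (y n))\<^sup>2 = 2 * (dist x (y m))\<^sup>2 + 2 * (dist x (y n))\<^sup>2
        - 4 * (dist x ((1/2) *\<^sub>R (y m + y n)))\<^sup>2"
      by (simp add: dist_norm power2_norm_eq_inner algebra_simps inner_commute)
    ultimately show ?thesis using y[of m] y[of n] by linarith
  qed
  have "Cauchy y"
  proof (rule metric_CauchyI)
    fix e :: real assume e: "0 < e"
    obtain M where M: "inverse (real (Suc M)) < e\<^sup>2 / 4"
      using reals_Archimedean[of "e\<^sup>2 / 4"] e by auto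
    show "\<exists>M. \<forall>m\<ge>M. \<forall>n\<ge>M. dist (y m) (y n) < e"
    proof (intro exI allI impI)
      fix m n assume "M \<le> m" "M \<le> n"
      then have "inverse (real (Suc m)) \<le> inverse (real (Suc M))"
        "inverse (real (Suc n)) \<le> inverse (real (Suc M))"
        by (auto intro!: le_imp_inverse_le)
      then have "(dist (y m) (y n))\<^sup>2 < e\<^sup>2" using near[of m n] M by linarith
      then show "dist (y m) (y n) < e" using e by (simp add: power_less_imp_less_base)
    qed
  qed
  then obtain p where p: "y \<longlonglongrightarrow> p"
    using Cauchy_convergent convergent_def by blast
  have pV: "p \<in> V" using cl p yV closed_sequentially by blast
  have "(dist x p)\<^sup>2 \<le> d\<^sup>2"
  proof (rule LIMSEQ_le)
    show "(\<lambda>n. (dist x (y n))\<^sup>2) \<longlonglongrightarrow> (dist x p)\<^sup>2" by (intro tendsto_intros p)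
    show "(\<lambda>n. d\<^sup>2 + inverse (real (Suc n))) \<longlonglongrightarrow> d\<^sup>2"
      using tendsto_add[OF tendsto_const LIMSEQ_inverse_real_of_nat, of "d\<^sup>2"] by simp
    show "\<exists>N. \<forall>n\<ge>N. (dist x (y n))\<^sup>2 \<le> d\<^sup>2 + inverse (real (Suc n))"
      using y less_imp_le by blast
  qed
  then have "dist x p \<le> d" using d0 by (rule power2_le_imp_le)
  then have closest: "\<forall>z\<in>V. dist x p \<le> dist x z" using d_le by force
  have le0: "inner (x - p) v \<le> 0" if "v \<in> V" for v
    using any_closest_point_dot[OF subspace_imp_convex[OF V] cl pV subspace_add[OF V pV that] closest]
    by simp
  \<comment> \<open>applying the variational inequality to \<open>v\<close> and to \<open>- v\<close> turns it into an equality\<close>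
  have "inner (x - p) v = 0" if "v \<in> V" for v
    using le0[OF that] le0[OF subspace_neg[OF V that]] by simp
  then show ?thesis using pV by (auto simp: orthogonal_def)
qed

lemma orth_proj:
  fixes V :: "'a::{real_inner,complete_space} set"
  assumes V: "subspace V" and "closed V"
  shows orth_proj_in: "orth_proj V x \<in> V"
    and orth_proj_orthogonal: "v \<in> V \<Longrightarrow> orthogonal (x - orth_proj V x) v"
proof -
  have "\<exists>!y. y \<in> V \<and> (\<forall>v\<in>V. orthogonal (x - y) v)"
  proof (rule ex_ex1I)
    show "\<exists>y. y \<in> V \<and> (\<forall>v\<in>V. orthogonal (x - y) v)"
      using exists_orthogonal_projection[OF assms] by blast
  next
    fix y z
    assume y: "y \<in> V \<and> (\<forall>v\<in>V. orthogonal (x - y) v)"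
      and z: "z \<in> V \<and> (\<forall>v\<in>V. orthogonal (x - z) v)"
    then have "y - z \<in> V" using V subspace_diff by blast
    then have "inner (x - y) (y - z) = 0" "inner (x - z) (y - z) = 0"
      using y z by (auto simp: orthogonal_def)
    then have "inner (y - z) (y - z) = 0" by (simp add: inner_diff_left)
    then show "y = z" by simp
  qed
  from theI'[OF this] show "orth_proj V x \<in> V" "v \<in> V \<Longrightarrow> orthogonal (x - orth_proj V x) v"
    unfolding orth_proj_def by auto
qed

lemma dist_relaxed_proj: "dist x (relaxed_proj V l x) = \<bar>l\<bar> * dist x (orth_proj V x)"
proof -
  have "x - relaxed_proj V l x = l *\<^sub>R (x - orth_proj V x)"
    by (simp add: relaxed_proj_def algebra_simps)
  then show ?thesis by (simp add: dist_norm)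
qed

text \<open>
  By Pythagoras both squared distances to \<open>w\<close> split at the projection \<open>p\<close> of \<open>x\<close>, and only the
  component \<open>x - p\<close> is scaled, by \<open>1 - l\<close>.
\<close>

lemma relaxed_proj_fejer:
  fixes V :: "'a::{real_inner,complete_space} set"
  assumes V: "subspace V" "closed V" and \<eta>: "0 < \<eta>" and l: "\<eta> \<le> l" "l \<le> 2 - \<eta>" and w: "w \<in> V"
  shows "(dist (relaxed_proj V l x) w)\<^sup>2 + \<eta> / 2 * (dist x (relaxed_proj V l x))\<^sup>2 \<le> (dist x w)\<^sup>2"
proof -
  define p where "p = orth_proj V x"
  have pw: "inner (x - p) (p - w) = 0"
    using orth_proj_orthogonal[OF V subspace_diff[OF V(1) orth_proj_in[OF V] w]]
    by (simp add: p_def orthogonal_def)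
  have d: "(dist x (relaxed_proj V l x))\<^sup>2 = l\<^sup>2 * (norm (x - p))\<^sup>2"
    unfolding dist_relaxed_proj unfolding p_def dist_norm by (simp add: power_mult_distrib)
  have xw: "(dist x w)\<^sup>2 = (norm (x - p))\<^sup>2 + (norm (p - w))\<^sup>2"
    using norm_add_Pythagorean[of "x - p" "p - w"] pw by (simp add: orthogonal_def dist_norm)
  have rw: "(dist (relaxed_proj V l x) w)\<^sup>2 = (1 - l)\<^sup>2 * (norm (x - p))\<^sup>2 + (norm (p - w))\<^sup>2"
  proof -
    have "relaxed_proj V l x - w = (1 - l) *\<^sub>R (x - p) + (p - w)"
      by (simp add: relaxed_proj_def p_def algebra_simps)
    then have "(dist (relaxed_proj V l x) w)\<^sup>2 = (norm ((1 - l) *\<^sub>R (x - p) + (p - w)))\<^sup>2"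
      by (simp only: dist_norm)
    also have "(norm ((1 - l) *\<^sub>R (x - p) + (p - w)))\<^sup>2
        = (norm ((1 - l) *\<^sub>R (x - p)))\<^sup>2 + (norm (p - w))\<^sup>2"
      by (rule norm_add_Pythagorean) (simp add: orthogonal_def pw)
    finally show ?thesis by (simp add: power_mult_distrib)
  qed
  \<comment> \<open>\<open>1 - (1 - l)\<^sup>2 = l (2 - l)\<close>, and \<open>l \<eta> / 2 \<le> \<eta> \<le> 2 - l\<close>\<close>
  have "\<eta> * l / 2 \<le> 2 - l"
    using mult_left_mono[of l 2 \<eta>] l \<eta> by linarith
  then have "l * (\<eta> * l / 2) \<le> l * (2 - l)" using l \<eta> by (intro mult_left_mono) auto
  then have "(1 - l)\<^sup>2 + \<eta> / 2 * l\<^sup>2 \<le> 1" by (simp add: power2_eq_square algebra_simps)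
  then have "((1 - l)\<^sup>2 + \<eta> / 2 * l\<^sup>2) * (norm (x - p))\<^sup>2 \<le> (norm (x - p))\<^sup>2"
    using mult_right_mono[of _ 1 "(norm (x - p))\<^sup>2"] by fastforce
  then show ?thesis unfolding d xw rw by (simp add: algebra_simps)
qed

lemma relaxed_proj_progress:
  fixes V :: "'a::{real_inner,complete_space} set"
  assumes V: "subspace V" "closed V" and "0 \<le> \<eta>" "\<eta> \<le> l"
  shows "\<eta> * infdist x V \<le> dist x (relaxed_proj V l x)"
proof -
  have "\<eta> * infdist x V \<le> l * dist x (orth_proj V x)"
    by (intro mult_mono infdist_le orth_proj_in V) (use assms in \<open>auto simp: infdist_nonneg\<close>)
  also have "\<dots> = dist x (relaxed_proj V l x)"
    using assms by (simp add: dist_relaxed_proj)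
  finally show ?thesis .
qed


section \<open>Trajectories of strongly Fejer monotone steps\<close>

text \<open>
  The relation \<open>R i x y\<close> stands for an admissible step from \<open>x\<close> to \<open>y\<close> aimed at \<open>V i\<close>; for relaxed
  projections the relaxation parameter is hidden in it, which makes the bounds below uniform in the
  choice of the parameters. Regularity is phrased with an upper bound \<open>r\<close> on the distances instead
  of their maximum.
\<close>

locale fejer_steps =
  fixes V :: "'i \<Rightarrow> 'a::metric_space set"
    and R :: "'i \<Rightarrow> 'a \<Rightarrow> 'a \<Rightarrow> bool"
    and J :: "'i set"
    and c \<eta> :: real
  assumes finite_J: "finite J"
    and common_point: "(\<Inter>i\<in>J. V i) \<noteq> {}"
    and c_pos: "0 < c"
    and eta_pos: "0 < \<eta>"
    and fejer: "\<lbrakk>i \<in> J; R i x y; w \<in> V i\<rbrakk> \<Longrightarrow> (dist y w)\<^sup>2 + c * (dist x y)\<^sup>2 \<le> (dist x w)\<^sup>2"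
    and progress: "\<lbrakk>i \<in> J; R i x y\<rbrakk> \<Longrightarrow> \<eta> * infdist x (V i) \<le> dist x y"
    and regular: "\<lbrakk>I \<noteq> {}; I \<subseteq> J\<rbrakk> \<Longrightarrow>
       \<exists>\<kappa>. \<forall>x r. (\<forall>i\<in>I. infdist x (V i) \<le> r) \<longrightarrow> infdist x (\<Inter>i\<in>I. V i) \<le> \<kappa> * r"
begin

definition traj :: "nat \<Rightarrow> (nat \<Rightarrow> 'i) \<Rightarrow> (nat \<Rightarrow> 'a) \<Rightarrow> bool" where
  "traj n i x \<longleftrightarrow> (\<forall>k<n. R (i k) (x k) (x (Suc k)))"

definition gap :: "'i set \<Rightarrow> 'a \<Rightarrow> real" where
  "gap I x = infdist x (\<Inter>i\<in>I. V i)"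

definition summable_steps :: "'i set \<Rightarrow> real \<Rightarrow> bool" where
  "summable_steps I \<gamma> \<longleftrightarrow> (\<exists>C\<ge>0. \<forall>n i x. traj n i x \<longrightarrow> i ` {..<n} \<subseteq> I \<longrightarrow>
     (\<Sum>k<n. dist (x k) (x (Suc k)) powr \<gamma>) \<le> C * gap I (x 0) powr \<gamma>)"

text \<open>
  The range of indices has to be all of \<open>I\<close>: a set that is never used has no influence on the steps.
  Since \<open>K\<close> precedes \<open>n\<close>, the bound is uniform in how often indices are repeated. The condition
  \<open>0 \<le> \<delta>\<close> matters for the empty trajectory, which puts no constraint on \<open>\<delta>\<close>.
\<close>

definition controls_gap :: "'i set \<Rightarrow> bool" where
  "controls_gap I \<longleftrightarrow> (\<exists>K\<ge>0. \<forall>n i x \<delta>. traj n i x \<longrightarrow> i ` {..<n} = I \<longrightarrow> 0 \<le> \<delta> \<longrightarrow>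
     (\<forall>k<n. dist (x k) (x (Suc k)) \<le> \<delta>) \<longrightarrow> gap I (x 0) \<le> K * \<delta>)"

lemma gap_nonneg [simp]: "0 \<le> gap I x"
  by (simp add: gap_def infdist_nonneg)

lemma common_nonempty: "I \<subseteq> J \<Longrightarrow> (\<Inter>i\<in>I. V i) \<noteq> {}"
  using common_point by blast

lemma gap_mono: "\<lbrakk>I \<subseteq> I'; I' \<subseteq> J\<rbrakk> \<Longrightarrow> gap I x \<le> gap I' x"
  unfolding gap_def by (rule infdist_mono) (use common_nonempty in auto)

lemma traj_prefix: "\<lbrakk>traj n i x; m \<le> n\<rbrakk> \<Longrightarrow> traj m i x"
  by (simp add: traj_def)

lemma traj_shift: "\<lbrakk>traj n i x; m \<le> n\<rbrakk> \<Longrightarrow> traj (n - m) (\<lambda>k. i (k + m)) (\<lambda>k. x (k + m))"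
  by (simp add: traj_def)

text \<open>
  Strong Fejer monotonicity passes from points to the gap by taking the infimum over the common
  points, each of which lies in \<open>V i\<close>.
\<close>

lemma gap_step:
  assumes "I \<subseteq> J" "i \<in> I" "R i x y"
  shows "(gap I y)\<^sup>2 + c * (dist x y)\<^sup>2 \<le> (gap I x)\<^sup>2"
proof -
  let ?W = "\<Inter>i\<in>I. V i"
  have ne: "?W \<noteq> {}" using assms common_nonempty by blast
  have "sqrt ((gap I y)\<^sup>2 + c * (dist x y)\<^sup>2) \<le> gap I x"
    unfolding gap_def infdist_notempty[OF ne, of x]
  proof (rule cINF_greatest[OF ne])
    fix w assume w: "w \<in> ?W"
    have "(infdist y ?W)\<^sup>2 \<le> (dist y w)\<^sup>2"
      using w by (intro power_mono infdist_le infdist_nonneg)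
    moreover have "(dist y w)\<^sup>2 + c * (dist x y)\<^sup>2 \<le> (dist x w)\<^sup>2"
      using assms w by (intro fejer[of i]) auto
    ultimately show "sqrt ((infdist y ?W)\<^sup>2 + c * (dist x y)\<^sup>2) \<le> dist x w"
      by (intro real_le_lsqrt) auto
  qed
  then show ?thesis by (rule sqrt_le_D)
qed

lemma gap_decrease:
  assumes "I \<subseteq> J" "traj n i x" "i ` {..<n} \<subseteq> I"
  shows "(gap I (x n))\<^sup>2 + c * (\<Sum>k<n. (dist (x k) (x (Suc k)))\<^sup>2) \<le> (gap I (x 0))\<^sup>2"
  using assms(2,3)
proof (induction n)
  case (Suc n)
  have "(gap I (x n))\<^sup>2 + c * (\<Sum>k<n. (dist (x k) (x (Suc k)))\<^sup>2) \<le> (gap I (x 0))\<^sup>2"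
    using Suc by (intro Suc.IH) (auto simp: traj_def)
  moreover have "(gap I (x (Suc n)))\<^sup>2 + c * (dist (x n) (x (Suc n)))\<^sup>2 \<le> (gap I (x n))\<^sup>2"
    using Suc.prems assms(1) by (intro gap_step[of I "i n"]) (auto simp: traj_def)
  ultimately show ?case by (simp add: algebra_simps)
qed simp

text \<open>
  The index at time \<open>m\<close> completes \<open>I\<close>: it is the index whose first occurrence comes last. This cut
  is what reduces a trajectory over \<open>I\<close> to one over a proper subset.
\<close>

lemma first_covering_time:
  fixes n :: nat
  assumes "i ` {..<n} = I" "I \<noteq> {}"
  obtains m where "m < n" "i ` {..<m} \<subset> I" "I = insert (i m) (i ` {..<m})"
proof -
  define l where "l = (LEAST l. i ` {..<l} = I)"
  have l: "i ` {..<l} = I" unfolding l_def by (rule LeastI[of _ n]) (rule assms(1))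
  have ln: "l \<le> n" unfolding l_def by (rule Least_le) (rule assms(1))
  obtain m where m: "l = Suc m" using l assms(2) by (cases l) auto
  have "i ` {..<m} \<noteq> I" using not_less_Least[of m "\<lambda>l. i ` {..<l} = I"] m l_def by auto
  moreover have "I = insert (i m) (i ` {..<m})" using l m by (simp add: lessThan_Suc)
  ultimately show thesis using that[of m] ln m by auto
qed

text \<open>
  The index set used before the first covering time depends on the trajectory. As only finitely many
  sets are possible, one constant serves them all; the next lemmas record this for both
  halves of the induction.
\<close>

lemma uniform_constant:
  fixes P :: "'b \<Rightarrow> real \<Rightarrow> bool"
  assumes "finite A" and ex: "\<And>a. a \<in> A \<Longrightarrow> \<exists>C\<ge>0. P a C"
    and mono: "\<And>a C C'. \<lbrakk>P a C; C \<le> C'\<rbrakk> \<Longrightarrow> P a C'"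
  shows "\<exists>C\<ge>0. \<forall>a\<in>A. P a C"
proof -
  obtain f where f: "\<And>a. a \<in> A \<Longrightarrow> 0 \<le> f a \<and> P a (f a)" using ex by metis
  have "f a \<le> sum f A" if "a \<in> A" for a
    using f that assms(1) by (intro member_le_sum) auto
  moreover have "0 \<le> sum f A" using f by (simp add: sum_nonneg)
  ultimately show ?thesis using f mono by blast
qed

lemma uniform_summable_steps:
  assumes "I \<subseteq> J" and sub: "\<And>I'. I' \<subset> I \<Longrightarrow> summable_steps I' \<gamma>"
  obtains C where "0 \<le> C"
    "\<And>n i x. \<lbrakk>traj n i x; i ` {..<n} \<subset> I\<rbrakk> \<Longrightarrow>
       (\<Sum>k<n. dist (x k) (x (Suc k)) powr \<gamma>) \<le> C * gap (i ` {..<n}) (x 0) powr \<gamma>"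
proof -
  have fin: "finite {I'. I' \<subset> I}"
    using finite_subset[OF assms(1) finite_J] by (auto intro: finite_subset[of _ "Pow I"])
  have "\<exists>C\<ge>0. \<forall>I'\<in>{I'. I' \<subset> I}. \<forall>n i x. traj n i x \<longrightarrow> i ` {..<n} \<subseteq> I' \<longrightarrow>
     (\<Sum>k<n. dist (x k) (x (Suc k)) powr \<gamma>) \<le> C * gap I' (x 0) powr \<gamma>"
  proof (rule uniform_constant[OF fin])
    fix I' C C' assume "C \<le> (C'::real)" and H: "\<forall>n i x. traj n i x \<longrightarrow> i ` {..<n} \<subseteq> I' \<longrightarrow>
     (\<Sum>k<n. dist (x k) (x (Suc k)) powr \<gamma>) \<le> C * gap I' (x 0) powr \<gamma>"
    then have "C * gap I' (x 0) powr \<gamma> \<le> C' * gap I' (x 0) powr \<gamma>" for x :: "nat \<Rightarrow> 'a"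
      by (intro mult_right_mono) auto
    then show "\<forall>n i x. traj n i x \<longrightarrow> i ` {..<n} \<subseteq> I' \<longrightarrow>
     (\<Sum>k<n. dist (x k) (x (Suc k)) powr \<gamma>) \<le> C' * gap I' (x 0) powr \<gamma>"
      using H order_trans by blast
  qed (use sub in \<open>auto simp: summable_steps_def\<close>)
  then obtain C where "0 \<le> C" and C: "\<forall>I'\<in>{I'. I' \<subset> I}. \<forall>n i x. traj n i x \<longrightarrow> i ` {..<n} \<subseteq> I' \<longrightarrow>
     (\<Sum>k<n. dist (x k) (x (Suc k)) powr \<gamma>) \<le> C * gap I' (x 0) powr \<gamma>"
    by (elim exE conjE) (rule that)
  show thesis
  proof (rule that[OF \<open>0 \<le> C\<close>])
    fix n i x assume "traj n i x" "i ` {..<n} \<subset> I"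
    then show "(\<Sum>k<n. dist (x k) (x (Suc k)) powr \<gamma>) \<le> C * gap (i ` {..<n}) (x 0) powr \<gamma>"
      using C[rule_format, of "i ` {..<n}" n i x] by simp
  qed
qed

lemma uniform_controls_gap:
  assumes "I \<subseteq> J" and sub: "\<And>I'. I' \<subset> I \<Longrightarrow> controls_gap I'"
  obtains K where "0 \<le> K"
    "\<And>n i x \<delta>. \<lbrakk>traj n i x; i ` {..<n} \<subset> I; 0 \<le> \<delta>; \<And>k. k < n \<Longrightarrow> dist (x k) (x (Suc k)) \<le> \<delta>\<rbrakk> \<Longrightarrow>
       gap (i ` {..<n}) (x 0) \<le> K * \<delta>"
proof -
  have fin: "finite {I'. I' \<subset> I}"
    using finite_subset[OF assms(1) finite_J] by (auto intro: finite_subset[of _ "Pow I"])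
  have "\<exists>K\<ge>0. \<forall>I'\<in>{I'. I' \<subset> I}. \<forall>n i x \<delta>. traj n i x \<longrightarrow> i ` {..<n} = I' \<longrightarrow> 0 \<le> \<delta> \<longrightarrow>
     (\<forall>k<n. dist (x k) (x (Suc k)) \<le> \<delta>) \<longrightarrow> gap I' (x 0) \<le> K * \<delta>"
  proof (rule uniform_constant[OF fin])
    fix I' C C' assume "C \<le> (C'::real)" and H: "\<forall>n i x \<delta>. traj n i x \<longrightarrow> i ` {..<n} = I' \<longrightarrow> 0 \<le> \<delta> \<longrightarrow>
     (\<forall>k<n. dist (x k) (x (Suc k)) \<le> \<delta>) \<longrightarrow> gap I' (x 0) \<le> C * \<delta>"
    show "\<forall>n i x \<delta>. traj n i x \<longrightarrow> i ` {..<n} = I' \<longrightarrow> 0 \<le> \<delta> \<longrightarrow>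
     (\<forall>k<n. dist (x k) (x (Suc k)) \<le> \<delta>) \<longrightarrow> gap I' (x 0) \<le> C' * \<delta>"
    proof (intro allI impI)
      fix n i x \<delta>
      assume "traj n i x" "i ` {..<n} = I'" and \<delta>: "0 \<le> \<delta>"
        and "\<forall>k<n. dist (x k) (x (Suc k)) \<le> \<delta>"
      then have "gap I' (x 0) \<le> C * \<delta>" by (intro H[rule_format]) auto
      also have "\<dots> \<le> C' * \<delta>" using \<open>C \<le> C'\<close> \<delta> by (rule mult_right_mono)
      finally show "gap I' (x 0) \<le> C' * \<delta>" .
    qed
  qed (use sub in \<open>simp add: controls_gap_def\<close>)
  then obtain K where "0 \<le> K" and K: "\<forall>I'\<in>{I'. I' \<subset> I}. \<forall>n i x \<delta>. traj n i x \<longrightarrow> i ` {..<n} = I' \<longrightarrow>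
     0 \<le> \<delta> \<longrightarrow> (\<forall>k<n. dist (x k) (x (Suc k)) \<le> \<delta>) \<longrightarrow> gap I' (x 0) \<le> K * \<delta>"
    by (elim exE conjE) (rule that)
  show thesis
  proof (rule that[OF \<open>0 \<le> K\<close>])
    fix n i x \<delta>
    assume "traj n i x" "i ` {..<n} \<subset> I" "0 \<le> \<delta>" "\<And>k. k < n \<Longrightarrow> dist (x k) (x (Suc k)) \<le> \<delta>"
    then show "gap (i ` {..<n}) (x 0) \<le> K * \<delta>"
      using K[rule_format, of "i ` {..<n}" n i x \<delta>] by simp
  qed
qed

text \<open>
  Small steps do not by themselves keep a long trajectory near its starting point. The induction
  hypothesis with exponent 1 does: the drift before the first covering time is at most a constant
  times a gap that is already known to be \<open>O(\<delta>)\<close>. Hence what the last index reveals about the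
  point reached transfers to the starting point.
\<close>

lemma controls_gap_step:
  assumes I: "I \<subseteq> J"
    and cov: "\<And>I'. I' \<subset> I \<Longrightarrow> controls_gap I'"
    and steps: "\<And>I'. I' \<subset> I \<Longrightarrow> summable_steps I' 1"
  shows "controls_gap I"
proof (cases "I = {}")
  case True
  then have "gap I x = 0" for x by (simp add: gap_def)
  then show ?thesis unfolding controls_gap_def by (intro exI[of _ 0]) auto
next
  case False
  obtain C where C: "0 \<le> C" "\<And>n i x. \<lbrakk>traj n i x; i ` {..<n} \<subset> I\<rbrakk> \<Longrightarrow>
       (\<Sum>k<n. dist (x k) (x (Suc k)) powr 1) \<le> C * gap (i ` {..<n}) (x 0) powr 1"
    using uniform_summable_steps[OF I steps] by metis
  obtain K where K: "0 \<le> K"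
    "\<And>n i x \<delta>. \<lbrakk>traj n i x; i ` {..<n} \<subset> I; 0 \<le> \<delta>; \<And>k. k < n \<Longrightarrow> dist (x k) (x (Suc k)) \<le> \<delta>\<rbrakk> \<Longrightarrow>
       gap (i ` {..<n}) (x 0) \<le> K * \<delta>"
    using uniform_controls_gap[OF I cov] by metis
  obtain \<kappa> where \<kappa>: "\<And>x r. (\<And>i. i \<in> I \<Longrightarrow> infdist x (V i) \<le> r) \<Longrightarrow> gap I x \<le> \<kappa> * r"
    using regular[OF False I] unfolding gap_def by blast
  \<comment> \<open>\<open>K\<close> serves the indices already used, \<open>C * K + inverse \<eta>\<close> (drift plus last step) the last one\<close>
  define r where "r = K + C * K + inverse \<eta>"
  have r0: "0 \<le> r" using C K eta_pos by (simp add: r_def)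
  have "gap I (x 0) \<le> max \<kappa> 0 * r * \<delta>"
    if T: "traj n i x" "i ` {..<n} = I" and \<delta>: "0 \<le> \<delta>" "\<forall>k<n. dist (x k) (x (Suc k)) \<le> \<delta>"
    for n i x \<delta>
  proof -
    from first_covering_time[OF T(2) False] obtain m where
      m: "m < n" "i ` {..<m} \<subset> I" "I = insert (i m) (i ` {..<m})" .
    have Tm: "traj m i x" using traj_prefix[OF T(1)] m by simp
    have gapm: "gap (i ` {..<m}) (x 0) \<le> K * \<delta>"
      using K(2)[OF Tm m(2) \<delta>(1)] \<delta>(2) m(1) by auto
    have "dist (x 0) (x m) \<le> (\<Sum>k<m. dist (x k) (x (Suc k)))"
    proof (induction m)
      case (Suc m)
      then show ?case using dist_triangle[of "x 0" "x (Suc m)" "x m"] by simp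
    qed simp
    also have "\<dots> \<le> C * gap (i ` {..<m}) (x 0)" using C(2)[OF Tm m(2)] by simp
    also have "\<dots> \<le> C * (K * \<delta>)" using gapm C(1) by (intro mult_left_mono)
    finally have drift: "dist (x 0) (x m) \<le> C * (K * \<delta>)" .
    have imJ: "i m \<in> J" and Rm: "R (i m) (x m) (x (Suc m))"
      using m I T(1) by (auto simp: traj_def)
    have "\<eta> * infdist (x m) (V (i m)) \<le> \<delta>" using progress[OF imJ Rm] \<delta>(2) m(1) by force
    then have last: "infdist (x m) (V (i m)) \<le> inverse \<eta> * \<delta>"
      using eta_pos by (simp add: field_simps)
    have "infdist (x 0) (V j) \<le> r * \<delta>" if j: "j \<in> I" for j
    proof (cases "j = i m")
      case True
      have "infdist (x 0) (V j) \<le> inverse \<eta> * \<delta> + C * (K * \<delta>)"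
        using infdist_triangle[of "x 0" "V j" "x m"] last drift True by simp
      also have "\<dots> \<le> r * \<delta>" using K(1) \<delta>(1) by (simp add: r_def algebra_simps)
      finally show ?thesis .
    next
      case False
      then have "j \<in> i ` {..<m}" using j m(3) by auto
      then have "infdist (x 0) (V j) \<le> gap (i ` {..<m}) (x 0)"
        using gap_mono[of "{j}" "i ` {..<m}" "x 0"] m I by (auto simp: gap_def)
      also have "\<dots> \<le> K * \<delta>" by (rule gapm)
      also have "\<dots> \<le> r * \<delta>" using K(1) C(1) \<delta>(1) eta_pos by (intro mult_right_mono) (auto simp: r_def)
      finally show ?thesis .
    qed
    then have "gap I (x 0) \<le> \<kappa> * (r * \<delta>)" by (rule \<kappa>)
    also have "\<dots> \<le> max \<kappa> 0 * (r * \<delta>)" using r0 \<delta>(1) by (intro mult_right_mono) auto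
    finally show ?thesis by (simp add: mult.assoc)
  qed
  moreover have "0 \<le> max \<kappa> 0 * r" using r0 by simp
  ultimately show ?thesis unfolding controls_gap_def by blast
qed

text \<open>
  Every squared step length is at most \<open>D / c\<close>, where \<open>D\<close> is the decrease of the squared gap. So the
  initial squared gap is at most a multiple of its own decrease, which forces a contraction.
\<close>

lemma covering_contracts:
  assumes I: "I \<subseteq> J" and "controls_gap I"
  obtains q where "0 \<le> q" "q < 1"
    "\<And>n i x. \<lbrakk>traj n i x; i ` {..<n} = I\<rbrakk> \<Longrightarrow> gap I (x n) \<le> q * gap I (x 0)"
proof -
  obtain K where K: "0 \<le> K" "\<And>n i x \<delta>. \<lbrakk>traj n i x; i ` {..<n} = I; 0 \<le> \<delta>;
     \<forall>k<n. dist (x k) (x (Suc k)) \<le> \<delta>\<rbrakk> \<Longrightarrow> gap I (x 0) \<le> K * \<delta>"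
    using assms(2) unfolding controls_gap_def by blast
  \<comment> \<open>the summand 1 makes \<open>M\<close> at least 1, so that \<open>1 - 1 / M\<close> lies in \<open>[0, 1)\<close>\<close>
  define M where "M = K\<^sup>2 / c + 1"
  have M1: "1 \<le> M" using c_pos by (simp add: M_def)
  have "gap I (x n) \<le> sqrt (1 - 1 / M) * gap I (x 0)"
    if T: "traj n i x" "i ` {..<n} = I" for n i x
  proof -
    define D where "D = (gap I (x 0))\<^sup>2 - (gap I (x n))\<^sup>2"
    have dec: "c * (\<Sum>k<n. (dist (x k) (x (Suc k)))\<^sup>2) \<le> D"
      using gap_decrease[OF I T(1)] T(2) by (simp add: D_def)
    moreover have "0 \<le> c * (\<Sum>k<n. (dist (x k) (x (Suc k)))\<^sup>2)"
      using c_pos by (simp add: sum_nonneg)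
    ultimately have D0: "0 \<le> D" by linarith
    have "dist (x k) (x (Suc k)) \<le> sqrt (D / c)" if "k < n" for k
    proof -
      have "(dist (x k) (x (Suc k)))\<^sup>2 \<le> (\<Sum>k<n. (dist (x k) (x (Suc k)))\<^sup>2)"
        using that by (intro member_le_sum) auto
      also have "\<dots> \<le> D / c" using dec c_pos by (simp add: field_simps)
      finally show ?thesis by (rule real_le_rsqrt)
    qed
    then have "gap I (x 0) \<le> K * sqrt (D / c)"
      using K(2)[OF T, of "sqrt (D / c)"] D0 c_pos by auto
    then have "(gap I (x 0))\<^sup>2 \<le> (K * sqrt (D / c))\<^sup>2" by (intro power_mono) auto
    also have "\<dots> = K\<^sup>2 / c * D" using D0 c_pos by (simp add: power_mult_distrib)
    also have "\<dots> \<le> M * D" using D0 by (intro mult_right_mono) (auto simp: M_def)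
    finally have "(gap I (x n))\<^sup>2 \<le> (1 - 1 / M) * (gap I (x 0))\<^sup>2"
      using M1 by (simp add: D_def field_simps)
    then have "gap I (x n) \<le> sqrt ((1 - 1 / M) * (gap I (x 0))\<^sup>2)" by (rule real_le_rsqrt)
    then show ?thesis by (simp add: real_sqrt_mult)
  qed
  moreover have "0 \<le> sqrt (1 - 1 / M)" "sqrt (1 - 1 / M) < 1" using M1 by auto
  ultimately show thesis using that by blast
qed

text \<open>
  One block costs at most \<open>B\<close> times the \<open>\<gamma>\<close>-th power of its initial gap: \<open>C'\<close> for the steps before
  the covering time, the other summand for the covering step. After it the gap has shrunk by the
  factor \<open>q\<close>, so the total constant \<open>C\<close> is the sum of the geometric series
  \<open>B + B * q powr \<gamma> + \<dots>\<close>, used through its fixed-point equation \<open>B + C * q powr \<gamma> = C\<close> in a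
  strong induction on the length.
\<close>

lemma summable_steps_step:
  assumes I: "I \<subseteq> J" and \<gamma>: "0 < \<gamma>"
    and cov: "controls_gap I"
    and steps: "\<And>I'. I' \<subset> I \<Longrightarrow> summable_steps I' \<gamma>"
  shows "summable_steps I \<gamma>"
proof -
  let ?s = "\<lambda>n x. \<Sum>k<n. dist (x k) (x (Suc k)) powr \<gamma>"
  obtain C' where C': "0 \<le> C'" "\<And>n i x. \<lbrakk>traj n i x; i ` {..<n} \<subset> I\<rbrakk> \<Longrightarrow>
       ?s n x \<le> C' * gap (i ` {..<n}) (x 0) powr \<gamma>"
    using uniform_summable_steps[OF I steps] by metis
  obtain q where q: "0 \<le> q" "q < 1"
    "\<And>n i x. \<lbrakk>traj n i x; i ` {..<n} = I\<rbrakk> \<Longrightarrow> gap I (x n) \<le> q * gap I (x 0)"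
    using covering_contracts[OF I cov] by metis
  define B where "B = C' + (1 / sqrt c) powr \<gamma>"
  define C where "C = B / (1 - q powr \<gamma>)"
  have q1: "q powr \<gamma> < 1" using q \<gamma> powr_less_mono2[of \<gamma> q 1] by simp
  have B0: "0 \<le> B" using C' by (simp add: B_def)
  have C0: "0 \<le> C" using B0 q1 by (simp add: C_def)
  have BC: "B + C * q powr \<gamma> = C" using q1 by (simp add: C_def field_simps)
  have C'C: "C' \<le> C"
  proof -
    have "C' \<le> B" by (simp add: B_def)
    also have "\<dots> \<le> C" using BC C0 by (metis le_add_same_cancel1 mult_nonneg_nonneg powr_ge_zero)
    finally show ?thesis .
  qed
  have proper: "?s n x \<le> C' * gap I (x 0) powr \<gamma>" if "traj n i x" "i ` {..<n} \<subset> I" for n i x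
  proof -
    have "?s n x \<le> C' * gap (i ` {..<n}) (x 0) powr \<gamma>" by (rule C'(2)[OF that])
    also have "\<dots> \<le> C' * gap I (x 0) powr \<gamma>"
      using C'(1) \<gamma> that I by (intro mult_left_mono powr_mono2 gap_mono) auto
    finally show ?thesis .
  qed
  have "?s n x \<le> C * gap I (x 0) powr \<gamma>" if "traj n i x" "i ` {..<n} \<subseteq> I" for n i x
    using that
  proof (induction n arbitrary: i x rule: less_induct)
    case (less n)
    note T = less.prems
    let ?g = "gap I (x 0) powr \<gamma>"
    consider "n = 0" | "i ` {..<n} \<subset> I" | "i ` {..<n} = I" "I \<noteq> {}" using T(2) by blast
    then show ?case
    proof cases
      case 1
      then show ?thesis using C0 by simp
    next
      case 2
      have "C' * ?g \<le> C * ?g" using C'C by (intro mult_right_mono) auto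
      then show ?thesis using proper[OF T(1) 2] by linarith
    next
      case 3
      from first_covering_time[OF 3] obtain m where
        m: "m < n" "i ` {..<m} \<subset> I" "I = insert (i m) (i ` {..<m})" .
      have block: "traj (Suc m) i x" "i ` {..<Suc m} = I"
        using traj_prefix[OF T(1)] m by (auto simp: lessThan_Suc)
      have rest: "?s (n - Suc m) (\<lambda>k. x (k + Suc m)) \<le> C * gap I (x (0 + Suc m)) powr \<gamma>"
      proof (rule less.IH)
        show "traj (n - Suc m) (\<lambda>k. i (k + Suc m)) (\<lambda>k. x (k + Suc m))"
          using traj_shift[OF T(1), of "Suc m"] m(1) by simp
        show "(\<lambda>k. i (k + Suc m)) ` {..<n - Suc m} \<subseteq> I" using T(2) by auto
      qed (use m(1) in auto)
      have "gap I (x (Suc m)) powr \<gamma> \<le> (q * gap I (x 0)) powr \<gamma>"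
        using q(3)[OF block] \<gamma> by (intro powr_mono2) auto
      also have "\<dots> = q powr \<gamma> * ?g" using q(1) by (simp add: powr_mult)
      finally have "C * gap I (x (Suc m)) powr \<gamma> \<le> C * (q powr \<gamma> * ?g)"
        using C0 by (intro mult_left_mono) auto
      with rest have rest': "?s (n - Suc m) (\<lambda>k. x (k + Suc m)) \<le> C * q powr \<gamma> * ?g"
        by simp
      have "c * (dist (x m) (x (Suc m)))\<^sup>2 \<le> c * (\<Sum>k<Suc m. (dist (x k) (x (Suc k)))\<^sup>2)"
        using c_pos by (simp add: sum_nonneg)
      also have "\<dots> \<le> (gap I (x 0))\<^sup>2"
        using gap_decrease[OF I block(1)] block(2) by (smt (verit) order_refl zero_le_power2)
      finally have "(dist (x m) (x (Suc m)))\<^sup>2 \<le> (1 / sqrt c * gap I (x 0))\<^sup>2"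
        using c_pos by (simp add: power_mult_distrib power_divide pos_le_divide_eq mult.commute)
      then have "dist (x m) (x (Suc m)) \<le> 1 / sqrt c * gap I (x 0)"
        by (rule power2_le_imp_le) (use c_pos in simp)
      then have "dist (x m) (x (Suc m)) powr \<gamma> \<le> (1 / sqrt c * gap I (x 0)) powr \<gamma>"
        using \<gamma> by (intro powr_mono2) auto
      also have "\<dots> = (1 / sqrt c) powr \<gamma> * ?g" by (rule powr_mult)
      finally have last: "dist (x m) (x (Suc m)) powr \<gamma> \<le> (1 / sqrt c) powr \<gamma> * ?g" .
      have "?s m x \<le> C' * ?g"
        using traj_prefix[OF T(1)] m by (intro proper[of m i]) auto
      moreover have "?s n x = ?s m x + dist (x m) (x (Suc m)) powr \<gamma>
          + ?s (n - Suc m) (\<lambda>k. x (k + Suc m))"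
      proof -
        have "(\<Sum>k<Suc m + j. f k) = (\<Sum>k<Suc m. f k) + (\<Sum>k<j. f (k + Suc m))" for f :: "nat \<Rightarrow> real" and j
          by (induction j) (simp_all add: algebra_simps)
        from this[of "\<lambda>k. dist (x k) (x (Suc k)) powr \<gamma>" "n - Suc m"] show ?thesis
          using m(1) by simp
      qed
      ultimately have "?s n x \<le> (C' + (1 / sqrt c) powr \<gamma> + C * q powr \<gamma>) * ?g"
        using last rest' by (simp add: algebra_simps)
      then show ?thesis using BC by (simp add: B_def)
    qed
  qed
  then show ?thesis using C0 unfolding summable_steps_def by blast
qed

text \<open>
  All exponents have to be carried through the induction together, since the first half for a larger
  set relies on exponent 1 for its proper subsets.
\<close>

theorem all_steps_summable:
  assumes "0 < \<gamma>"
  shows "summable_steps J \<gamma>"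
proof -
  have "I \<subseteq> J \<Longrightarrow> controls_gap I \<and> (\<forall>\<gamma>>0. summable_steps I \<gamma>)" if "finite I" for I
    using that
  proof (induction I rule: finite_psubset_induct)
    case (psubset I)
    have IH: "controls_gap I' \<and> (\<forall>\<gamma>>0. summable_steps I' \<gamma>)" if "I' \<subset> I" for I'
      using psubset.IH[OF that] psubset.prems that by blast
    have "controls_gap I" by (rule controls_gap_step[OF psubset.prems]) (use IH in auto)
    moreover have "summable_steps I \<gamma>" if "0 < \<gamma>" for \<gamma>
      by (rule summable_steps_step[OF psubset.prems that \<open>controls_gap I\<close>]) (use IH that in auto)
    ultimately show ?case by blast
  qed
  then show ?thesis using finite_J assms by blast
qed

end


section \<open>Random products of relaxed projections\<close>

theorem theorem1p1:
  fixes V :: "nat \<Rightarrow> 'a::{real_inner,complete_space} set"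
    and N :: nat and \<eta> \<gamma> :: real
  assumes "N \<ge> 1"
    and "\<And>i. i \<in> {1..N} \<Longrightarrow> subspace (V i)"
    and "\<And>i. i \<in> {1..N} \<Longrightarrow> closed (V i)"
    and "innately_regular {1..N} V"
    and "0 < \<eta>" and "\<eta> \<le> 1"
    and "0 < \<gamma>"
  shows "\<exists>C::real. \<forall>(x0::'a) (i :: nat \<Rightarrow> nat) (l :: nat \<Rightarrow> real) (x :: nat \<Rightarrow> 'a).
           (\<forall>n. i n \<in> {1..N}) \<longrightarrow>
           (\<forall>n. l n \<in> {\<eta>..2 - \<eta>}) \<longrightarrow>
           x 0 = x0 \<longrightarrow>
           (\<forall>n. x (Suc n) = relaxed_proj (V (i n)) (l n) (x n)) \<longrightarrow>
           summable (\<lambda>n. norm (x (Suc n) - x n) powr \<gamma>) \<and>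
           (\<Sum>n. norm (x (Suc n) - x n) powr \<gamma>) \<le> C * norm x0 powr \<gamma>"
proof -
  define R where "R = (\<lambda>i x y. \<exists>l\<in>{\<eta>..2 - \<eta>}. y = relaxed_proj (V i) l x)"
  \<comment> \<open>\<open>0\<close> serves as the common point, and the distance to it bounds the initial gap by the norm\<close>
  have zero: "0 \<in> (\<Inter>i\<in>{1..N}. V i)" using assms(2) subspace_0 by blast
  interpret fejer_steps V R "{1..N}" "\<eta> / 2" \<eta>
  proof
    show "(\<Inter>i\<in>{1..N}. V i) \<noteq> {}" using zero by blast
    show "(dist y w)\<^sup>2 + \<eta> / 2 * (dist x y)\<^sup>2 \<le> (dist x w)\<^sup>2"
      if "i \<in> {1..N}" "R i x y" "w \<in> V i" for i x y w
      using that assms relaxed_proj_fejer[of "V i" \<eta> _ w x] by (auto simp: R_def)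
    show "\<eta> * infdist x (V i) \<le> dist x y" if "i \<in> {1..N}" "R i x y" for i x y
      using that assms relaxed_proj_progress[of "V i" \<eta> _ x] by (auto simp: R_def)
    show "\<exists>\<kappa>. \<forall>x r. (\<forall>i\<in>I. infdist x (V i) \<le> r) \<longrightarrow> infdist x (\<Inter>i\<in>I. V i) \<le> \<kappa> * r"
      if I: "I \<noteq> {}" "I \<subseteq> {1..N}" for I
    proof -
      obtain \<kappa> where \<kappa>: "\<And>x. infdist x (\<Inter>i\<in>I. V i) \<le> \<kappa> * Max ((\<lambda>i. infdist x (V i)) ` I)"
        using assms(4) I unfolding innately_regular_def regular_family_def by blast
      have fin: "finite I" using I(2) finite_subset by blast
      have "infdist x (\<Inter>i\<in>I. V i) \<le> max \<kappa> 0 * r" if r: "\<forall>i\<in>I. infdist x (V i) \<le> r" for x r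
      proof -
        let ?M = "Max ((\<lambda>i. infdist x (V i)) ` I)"
        have "?M \<in> (\<lambda>i. infdist x (V i)) ` I" using fin I(1) by (intro Max_in) auto
        then have M: "0 \<le> ?M" "?M \<le> r" using r infdist_nonneg by (fastforce, fastforce)
        have "infdist x (\<Inter>i\<in>I. V i) \<le> \<kappa> * ?M" by (rule \<kappa>)
        also have "\<dots> \<le> max \<kappa> 0 * r" using M by (intro mult_mono) auto
        finally show ?thesis .
      qed
      then show ?thesis by blast
    qed
  qed (use assms in auto)
  obtain C where C: "0 \<le> C" "\<And>n i x. \<lbrakk>traj n i x; i ` {..<n} \<subseteq> {1..N}\<rbrakk> \<Longrightarrow>
     (\<Sum>k<n. dist (x k) (x (Suc k)) powr \<gamma>) \<le> C * gap {1..N} (x 0) powr \<gamma>"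
    using all_steps_summable[OF assms(7)] unfolding summable_steps_def by blast
  show ?thesis
  proof (intro exI[of _ C] allI impI)
    fix x0 :: 'a and i :: "nat \<Rightarrow> nat" and l :: "nat \<Rightarrow> real" and x :: "nat \<Rightarrow> 'a"
    assume i: "\<forall>n. i n \<in> {1..N}" and l: "\<forall>n. l n \<in> {\<eta>..2 - \<eta>}" and x0: "x 0 = x0"
      and x: "\<forall>n. x (Suc n) = relaxed_proj (V (i n)) (l n) (x n)"
    have bound: "(\<Sum>k<n. norm (x (Suc k) - x k) powr \<gamma>) \<le> C * norm x0 powr \<gamma>" for n
    proof -
      have "R (i k) (x k) (x (Suc k))" for k using l x unfolding R_def by blast
      then have "traj n i x" by (simp add: traj_def)
      then have "(\<Sum>k<n. dist (x k) (x (Suc k)) powr \<gamma>) \<le> C * gap {1..N} (x 0) powr \<gamma>"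
        using i by (intro C(2)) auto
      also have "gap {1..N} (x 0) \<le> norm x0"
        using infdist_le[OF zero, of x0] x0 by (simp add: gap_def)
      then have "C * gap {1..N} (x 0) powr \<gamma> \<le> C * norm x0 powr \<gamma>"
        using C(1) assms(7) by (intro mult_left_mono powr_mono2) auto
      finally show ?thesis by (simp add: dist_norm norm_minus_commute)
    qed
    have "summable (\<lambda>n. norm (x (Suc n) - x n) powr \<gamma>)"
      by (rule summableI_nonneg_bounded[OF _ bound]) simp
    then show "summable (\<lambda>n. norm (x (Suc n) - x n) powr \<gamma>) \<and>
        (\<Sum>n. norm (x (Suc n) - x n) powr \<gamma>) \<le> C * norm x0 powr \<gamma>"
      using bound suminf_le_const by blast
  qed
qed

end
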